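(* Let $\mathcal K$ be a 2-category and $G=(G,d,e)$ a 2-comonad on $\mathcal K$. Let $(B,b)$ be a strict $G$-coalgebra, and let $u\colon B\to A$ be a morphism in $\mathcal K$ with a left adjoint $f\dashv u$, with unit $\eta\colon 1\to uf$ and counit $\epsilon\colon fu\to 1$. Then $A$ becomes a lax $G$-coalgebra $(A,a,\alpha,\alpha_0)$ where - $a=Gu\cdot b\cdot f\colon A\to GA$; - $\alpha\colon Ga\cdot a\Rightarrow dA\cdot a$ is the composite $$Ga\cdot a=G^2u\cdot Gb\cdot Gf\cdot Gu\cdot b\cdot f\xrightarrow{\;G^2u\cdot Gb\cdot G\epsilon\cdot b\cdot f\;}G^2u\cdot Gb\cdot b\cdot f=G^2u\cdot dB\cdot b\cdot f=dA\cdot Gu\cdot b\cdot f=dA\cdot a;$$ - $\alpha_0\colon 1_A\Rightarrow eA\cdot a$ is $$1_A\xrightarrow{\;\eta\;}u\cdot f=u\cdot eB\cdot b\cdot f=eA\cdot Gu\cdot b\cdot f=eA\cdot a;$$ and then $u$ becomes a lax $G$-morphism $(u,\overline u)$ from $(B,b)$ (regarded as a lax $G$-coalgebra with identity structure 2-cells) to $(A,a,\alpha,\alpha_0)$, where $\overline u\colon a\cdot u\Rightarrow Gu\cdot b$ is the 2-cell $$a\cdot u=Gu\cdot b\cdot f\cdot u\xrightarrow{\;Gu\cdot b\cdot\epsilon\;}Gu\cdot b.$$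
   Context: A 2-comonad $G=(G,d,e)$ on a 2-category $\mathcal K$ is a 2-functor $G\colon\mathcal K\to\mathcal K$ with 2-natural comultiplication $d\colon G\to G^2$ and counit $e\colon G\to 1$ satisfying the usual comonad laws strictly. A strict $G$-coalgebra $(B,b)$ is an object $B$ with $b\colon B\to GB$ satisfying $Gb\cdot b=dB\cdot b$ and $eB\cdot b=1$. Whiskering is denoted by $\cdot$ and vertical composition of 2-cells by $\circ$. **Lax $G$-coalgebra** $(A,a,\alpha,\alpha_0)$: an object $A$, a morphism $a\colon A\to GA$, and 2-cells $\alpha\colon Ga\cdot a\Rightarrow dA\cdot a$, $\alpha_0\colon 1_A\Rightarrow eA\cdot a$, such that: 1. $(GdA\cdot\alpha)\circ(G\alpha\cdot a)=(dGA\cdot\alpha)\circ(G^2a\cdot\alpha)$ as 2-cells $G^2a\cdot Ga\cdot a\Rightarrow dGA\cdot dA\cdot a$ (using $GdA\cdot dA=dGA\cdot dA$ and $G^2a\cdot dA=dGA\cdot Ga$); 2. $(GeA\cdot\alpha)\circ(G\alpha_0\cdot a)=1_a$; 3. $(eGA\cdot\alpha)\circ(a\cdot\alpha_0)=1_a$ (using $a\cdot eA=eGA\cdot Ga$). A strict $G$-coalgebra is a lax one with $\alpha,\alpha_0$ identities. **Lax $G$-morphism** $(h,\overline h)\colon(A,a,\alpha,\alpha_0)\to(B,b,\beta,\beta_0)$: a morphism $h\colon A\to B$ and a 2-cell $\overline h\colon b\cdot h\Rightarrow Gh\cdot a$ such that: 1. $(dB\cdot\overline h)\circ(\beta\cdot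 h)=(G^2h\cdot\alpha)\circ(G\overline h\cdot a)\circ(Gb\cdot\overline h)$ as 2-cells $Gb\cdot b\cdot h\Rightarrow G^2h\cdot dA\cdot a$; 2. $(eB\cdot\overline h)\circ(\beta_0\cdot h)=h\cdot\alpha_0$ as 2-cells $h\Rightarrow h\cdot eA\cdot a$. *)

theory Defs
  imports Main
begin

section \<open>Strict 2-categories\<close>

text \<open>
  A 2-category is given by carrier sets of objects, morphisms (1-cells) and 2-cells, so that
  all operations are constrained on the carriers only. \<open>src1\<close>/\<open>tgt1\<close> are the source and target
  object of a morphism, \<open>src2\<close>/\<open>tgt2\<close> the source and target morphism of a 2-cell.
  All compositions are written in the order of function composition.
\<close>

record ('o, 'm, 'c) two_cat =
  objects :: "'o set"
  arrows :: "'m set"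
  twocells :: "'c set"
  src1 :: "'m \<Rightarrow> 'o"
  tgt1 :: "'m \<Rightarrow> 'o"
  src2 :: "'c \<Rightarrow> 'm"
  tgt2 :: "'c \<Rightarrow> 'm"
  id1 :: "'o \<Rightarrow> 'm"
  comp1 :: "'m \<Rightarrow> 'm \<Rightarrow> 'm"  (infixr "\<cdot>\<index>" 75)
  id2 :: "'m \<Rightarrow> 'c"
  vcomp :: "'c \<Rightarrow> 'c \<Rightarrow> 'c"  (infixr "\<bullet>\<index>" 70)
  hcomp :: "'c \<Rightarrow> 'c \<Rightarrow> 'c"  (infixr "\<star>\<index>" 72)

definition hom1 :: "('o, 'm, 'c) two_cat \<Rightarrow> 'o \<Rightarrow> 'o \<Rightarrow> 'm set" where
  "hom1 K A B = {f \<in> arrows K. src1 K f = A \<and> tgt1 K f = B}"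

definition hom2 :: "('o, 'm, 'c) two_cat \<Rightarrow> 'm \<Rightarrow> 'm \<Rightarrow> 'c set" where
  "hom2 K f g = {\<sigma> \<in> twocells K. src2 K \<sigma> = f \<and> tgt2 K \<sigma> = g}"

definition whisker_left :: "('o, 'm, 'c) two_cat \<Rightarrow> 'm \<Rightarrow> 'c \<Rightarrow> 'c"
    (infixr "\<triangleright>\<index>" 73) where
  "whisker_left K g \<sigma> = hcomp K (id2 K g) \<sigma>"

definition whisker_right :: "('o, 'm, 'c) two_cat \<Rightarrow> 'c \<Rightarrow> 'm \<Rightarrow> 'c"
    (infixl "\<triangleleft>\<index>" 74) where
  "whisker_right K \<sigma> f = hcomp K \<sigma> (id2 K f)"

locale two_category =
  fixes K :: "('o, 'm, 'c) two_cat" (structure)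
  assumes src1_obj: "f \<in> arrows K \<Longrightarrow> src1 K f \<in> objects K"
    and tgt1_obj: "f \<in> arrows K \<Longrightarrow> tgt1 K f \<in> objects K"
    and id1_hom: "A \<in> objects K \<Longrightarrow> id1 K A \<in> hom1 K A A"
    and comp1_hom: "\<lbrakk>f \<in> hom1 K A B; g \<in> hom1 K B C\<rbrakk> \<Longrightarrow> g \<cdot> f \<in> hom1 K A C"
    and comp1_id_left: "f \<in> hom1 K A B \<Longrightarrow> id1 K B \<cdot> f = f"
    and comp1_id_right: "f \<in> hom1 K A B \<Longrightarrow> f \<cdot> id1 K A = f"
    and comp1_assoc: "\<lbrakk>f \<in> hom1 K A B; g \<in> hom1 K B C; h \<in> hom1 K C D\<rbrakk>
      \<Longrightarrow> (h \<cdot> g) \<cdot> f = h \<cdot> (g \<cdot> f)"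
    and src2_mor: "\<sigma> \<in> twocells K \<Longrightarrow> src2 K \<sigma> \<in> arrows K"
    and tgt2_mor: "\<sigma> \<in> twocells K \<Longrightarrow> tgt2 K \<sigma> \<in> arrows K"
    and src1_parallel: "\<sigma> \<in> twocells K \<Longrightarrow> src1 K (src2 K \<sigma>) = src1 K (tgt2 K \<sigma>)"
    and tgt1_parallel: "\<sigma> \<in> twocells K \<Longrightarrow> tgt1 K (src2 K \<sigma>) = tgt1 K (tgt2 K \<sigma>)"
    and id2_hom: "f \<in> arrows K \<Longrightarrow> id2 K f \<in> hom2 K f f"
    and vcomp_hom: "\<lbrakk>\<sigma> \<in> hom2 K f g; \<tau> \<in> hom2 K g h\<rbrakk> \<Longrightarrow> \<tau> \<bullet> \<sigma> \<in> hom2 K f h"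
    and vcomp_id_left: "\<sigma> \<in> hom2 K f g \<Longrightarrow> id2 K g \<bullet> \<sigma> = \<sigma>"
    and vcomp_id_right: "\<sigma> \<in> hom2 K f g \<Longrightarrow> \<sigma> \<bullet> id2 K f = \<sigma>"
    and vcomp_assoc: "\<lbrakk>\<rho> \<in> hom2 K f g; \<sigma> \<in> hom2 K g h; \<tau> \<in> hom2 K h k\<rbrakk>
      \<Longrightarrow> (\<tau> \<bullet> \<sigma>) \<bullet> \<rho> = \<tau> \<bullet> (\<sigma> \<bullet> \<rho>)"
    and hcomp_hom: "\<lbrakk>f \<in> hom1 K A B; g \<in> hom1 K B C; \<sigma> \<in> hom2 K f f'; \<tau> \<in> hom2 K g g'\<rbrakk>
      \<Longrightarrow> \<tau> \<star> \<sigma> \<in> hom2 K (g \<cdot> f) (g' \<cdot> f')"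
    and hcomp_id_left: "\<lbrakk>f \<in> hom1 K A B; \<sigma> \<in> hom2 K f f'\<rbrakk> \<Longrightarrow> id2 K (id1 K B) \<star> \<sigma> = \<sigma>"
    and hcomp_id_right: "\<lbrakk>f \<in> hom1 K A B; \<sigma> \<in> hom2 K f f'\<rbrakk> \<Longrightarrow> \<sigma> \<star> id2 K (id1 K A) = \<sigma>"
    and hcomp_assoc:
      "\<lbrakk>f \<in> hom1 K A B; g \<in> hom1 K B C; h \<in> hom1 K C D;
        \<rho> \<in> hom2 K f f'; \<sigma> \<in> hom2 K g g'; \<tau> \<in> hom2 K h h'\<rbrakk>
      \<Longrightarrow> (\<tau> \<star> \<sigma>) \<star> \<rho> = \<tau> \<star> (\<sigma> \<star> \<rho>)"
    and hcomp_id2: "\<lbrakk>f \<in> hom1 K A B; g \<in> hom1 K B C\<rbrakk>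
      \<Longrightarrow> id2 K g \<star> id2 K f = id2 K (g \<cdot> f)"
    and interchange:
      "\<lbrakk>f \<in> hom1 K A B; g \<in> hom1 K B C;
        \<sigma> \<in> hom2 K f f'; \<sigma>' \<in> hom2 K f' f''; \<tau> \<in> hom2 K g g'; \<tau>' \<in> hom2 K g' g''\<rbrakk>
      \<Longrightarrow> (\<tau>' \<bullet> \<tau>) \<star> (\<sigma>' \<bullet> \<sigma>) = (\<tau>' \<star> \<sigma>') \<bullet> (\<tau> \<star> \<sigma>)"


section \<open>2-functors and 2-natural transformations\<close>

record ('o, 'm, 'c, 'p, 'n, 'd) two_fun =
  ob :: "'o \<Rightarrow> 'p"
  mor :: "'m \<Rightarrow> 'n"
  cell :: "'c \<Rightarrow> 'd"

definition id_two_fun :: "('o, 'm, 'c, 'o, 'm, 'c) two_fun" where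
  "id_two_fun = \<lparr>ob = id, mor = id, cell = id\<rparr>"

definition comp_two_fun ::
  "('p, 'n, 'd, 'q, 'l, 'e) two_fun \<Rightarrow> ('o, 'm, 'c, 'p, 'n, 'd) two_fun
    \<Rightarrow> ('o, 'm, 'c, 'q, 'l, 'e) two_fun" where
  "comp_two_fun H F = \<lparr>ob = ob H \<circ> ob F, mor = mor H \<circ> mor F, cell = cell H \<circ> cell F\<rparr>"

locale two_functor = dom: two_category K + cod: two_category L
  for K :: "('o, 'm, 'c) two_cat" and L :: "('p, 'n, 'd) two_cat" +
  fixes F :: "('o, 'm, 'c, 'p, 'n, 'd) two_fun"
  assumes ob_obj: "A \<in> objects K \<Longrightarrow> ob F A \<in> objects L"
    and mor_hom: "f \<in> hom1 K A B \<Longrightarrow> mor F f \<in> hom1 L (ob F A) (ob F B)"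
    and cell_hom: "\<sigma> \<in> hom2 K f g \<Longrightarrow> cell F \<sigma> \<in> hom2 L (mor F f) (mor F g)"
    and mor_id1: "A \<in> objects K \<Longrightarrow> mor F (id1 K A) = id1 L (ob F A)"
    and mor_comp1: "\<lbrakk>f \<in> hom1 K A B; g \<in> hom1 K B C\<rbrakk>
      \<Longrightarrow> mor F (g \<cdot>\<^bsub>K\<^esub> f) = mor F g \<cdot>\<^bsub>L\<^esub> mor F f"
    and cell_id2: "f \<in> arrows K \<Longrightarrow> cell F (id2 K f) = id2 L (mor F f)"
    and cell_vcomp: "\<lbrakk>\<sigma> \<in> hom2 K f g; \<tau> \<in> hom2 K g h\<rbrakk>
      \<Longrightarrow> cell F (\<tau> \<bullet>\<^bsub>K\<^esub> \<sigma>) = cell F \<tau> \<bullet>\<^bsub>L\<^esub> cell F \<sigma>"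
    and cell_hcomp:
      "\<lbrakk>f \<in> hom1 K A B; g \<in> hom1 K B C; \<sigma> \<in> hom2 K f f'; \<tau> \<in> hom2 K g g'\<rbrakk>
      \<Longrightarrow> cell F (\<tau> \<star>\<^bsub>K\<^esub> \<sigma>) = cell F \<tau> \<star>\<^bsub>L\<^esub> cell F \<sigma>"

locale two_natural = dom: two_functor K L F + cod: two_functor K L F'
  for K :: "('o, 'm, 'c) two_cat" and L :: "('p, 'n, 'd) two_cat"
    and F F' :: "('o, 'm, 'c, 'p, 'n, 'd) two_fun" +
  fixes t :: "'o \<Rightarrow> 'n"
  assumes component_hom: "A \<in> objects K \<Longrightarrow> t A \<in> hom1 L (ob F A) (ob F' A)"
    and natural: "f \<in> hom1 K A B \<Longrightarrow> mor F' f \<cdot>\<^bsub>L\<^esub> t A = t B \<cdot>\<^bsub>L\<^esub> mor F f"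
    and natural2: "\<lbrakk>f \<in> hom1 K A B; \<sigma> \<in> hom2 K f g\<rbrakk>
      \<Longrightarrow> cell F' \<sigma> \<triangleleft>\<^bsub>L\<^esub> t A = t B \<triangleright>\<^bsub>L\<^esub> cell F \<sigma>"


section \<open>Adjunctions in a 2-category\<close>

text \<open>\<open>f \<stileturn> u\<close> with \<open>f : A \<rightarrow> B\<close>, unit \<open>\<eta>\<close> and counit \<open>\<epsilon>\<close>.\<close>

locale adjunction = two_category K
  for K :: "('o, 'm, 'c) two_cat" (structure) +
  fixes A B :: 'o and f u :: 'm and \<eta> \<epsilon> :: 'c
  assumes left_hom: "f \<in> hom1 K A B"
    and right_hom: "u \<in> hom1 K B A"
    and unit_hom: "\<eta> \<in> hom2 K (id1 K A) (u \<cdot> f)"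
    and counit_hom: "\<epsilon> \<in> hom2 K (f \<cdot> u) (id1 K B)"
    and triangle_left: "(\<epsilon> \<triangleleft> f) \<bullet> (f \<triangleright> \<eta>) = id2 K f"
    and triangle_right: "(u \<triangleright> \<epsilon>) \<bullet> (\<eta> \<triangleleft> u) = id2 K u"


section \<open>2-comonads, coalgebras and lax morphisms\<close>

locale two_comonad =
  two_functor K K G +
  comult: two_natural K K G "comp_two_fun G G" d +
  counit: two_natural K K G id_two_fun e
  for K :: "('o, 'm, 'c) two_cat" (structure)
    and G :: "('o, 'm, 'c, 'o, 'm, 'c) two_fun"
    and d e :: "'o \<Rightarrow> 'm" +
  assumes coassoc: "A \<in> objects K \<Longrightarrow> mor G (d A) \<cdot> d A = d (ob G A) \<cdot> d A"
    and counit_left: "A \<in> objects K \<Longrightarrow> e (ob G A) \<cdot> d A = id1 K (ob G A)"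
    and counit_right: "A \<in> objects K \<Longrightarrow> mor G (e A) \<cdot> d A = id1 K (ob G A)"

locale strict_coalgebra = two_comonad K G d e
  for K :: "('o, 'm, 'c) two_cat" (structure)
    and G :: "('o, 'm, 'c, 'o, 'm, 'c) two_fun" and d e :: "'o \<Rightarrow> 'm" +
  fixes B :: 'o and b :: 'm
  assumes carrier_obj: "B \<in> objects K"
    and coaction_hom: "b \<in> hom1 K B (ob G B)"
    and coaction_comult: "mor G b \<cdot> b = d B \<cdot> b"
    and coaction_counit: "e B \<cdot> b = id1 K B"

locale lax_coalgebra = two_comonad K G d e
  for K :: "('o, 'm, 'c) two_cat" (structure)
    and G :: "('o, 'm, 'c, 'o, 'm, 'c) two_fun" and d e :: "'o \<Rightarrow> 'm" +
  fixes A :: 'o and a :: 'm and \<alpha> \<alpha>\<^sub>0 :: 'c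
  assumes carrier_obj: "A \<in> objects K"
    and coaction_hom: "a \<in> hom1 K A (ob G A)"
    and lax_comult_hom: "\<alpha> \<in> hom2 K (mor G a \<cdot> a) (d A \<cdot> a)"
    and lax_counit_hom: "\<alpha>\<^sub>0 \<in> hom2 K (id1 K A) (e A \<cdot> a)"
    and lax_coassoc:
      "(mor G (d A) \<triangleright> \<alpha>) \<bullet> (cell G \<alpha> \<triangleleft> a)
        = (d (ob G A) \<triangleright> \<alpha>) \<bullet> (mor G (mor G a) \<triangleright> \<alpha>)"
    and lax_counit_right: "(mor G (e A) \<triangleright> \<alpha>) \<bullet> (cell G \<alpha>\<^sub>0 \<triangleleft> a) = id2 K a"
    and lax_counit_left: "(e (ob G A) \<triangleright> \<alpha>) \<bullet> (a \<triangleright> \<alpha>\<^sub>0) = id2 K a"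

locale lax_morphism =
  dom: lax_coalgebra K G d e A a \<alpha> \<alpha>\<^sub>0 + cod: lax_coalgebra K G d e B b \<beta> \<beta>\<^sub>0
  for K :: "('o, 'm, 'c) two_cat" (structure)
    and G :: "('o, 'm, 'c, 'o, 'm, 'c) two_fun" and d e :: "'o \<Rightarrow> 'm"
    and A :: 'o and a :: 'm and \<alpha> \<alpha>\<^sub>0 :: 'c
    and B :: 'o and b :: 'm and \<beta> \<beta>\<^sub>0 :: 'c +
  fixes h :: 'm and hbar :: 'c
  assumes mor_hom: "h \<in> hom1 K A B"
    and cell_hom: "hbar \<in> hom2 K (b \<cdot> h) (mor G h \<cdot> a)"
    and cell_comult:
      "(d B \<triangleright> hbar) \<bullet> (\<beta> \<triangleleft> h)
        = (mor G (mor G h) \<triangleright> \<alpha>) \<bullet> (cell G hbar \<triangleleft> a) \<bullet> (mor G b \<triangleright> hbar)"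
    and cell_counit: "(e B \<triangleright> hbar) \<bullet> (\<beta>\<^sub>0 \<triangleleft> h) = h \<triangleright> \<alpha>\<^sub>0"

end

theory Submission
  imports Defs
begin

text \<open>
  The adjunction \<open>f \<stileturn> u\<close> makes \<open>u f\<close> a monad on \<open>A\<close>, and \<open>a = Gu b f\<close> is the strict coaction
  \<open>b\<close> conjugated by \<open>f\<close> and \<open>u\<close>. Iterating \<open>a\<close> puts the composite \<open>Gf Gu\<close> between two copies of the
  coaction, and the only available way to remove it is the image \<open>G\<epsilon>\<close> of the adjunction counit;
  everything else in \<open>a\<close> is strict. Hence each axiom for the 2-cell \<open>\<alpha>\<close> reduces to one of the
  identities that \<open>\<epsilon>\<close> satisfies:

  \<^item> Coassociativity holds because two copies of \<open>f u\<close>, at different places of a composite, are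
    cancelled, and it does not matter which goes first. After the naturality of \<open>d\<close> and the strict
    coassociativity of \<open>b\<close> have been used, both sides are the whiskering by \<open>GGGu GGb\<close> and \<open>b f\<close> of one and the same horizontal
    composite, that of \<open>GG\<epsilon>\<close> with \<open>Gb G\<epsilon>\<close> (\<open>transported_coassoc\<close>).
  \<^item> The two counit laws are the two triangle identities: applying \<open>GeA\<close> to \<open>\<alpha>\<close> leaves \<open>Gu G\<epsilon>\<close>
    next to \<open>G\<eta> Gu\<close>, while \<open>eGA\<close> strips one \<open>G\<close> off \<open>G\<epsilon>\<close> and leaves \<open>\<epsilon> f\<close> next to \<open>f \<eta>\<close>
    (\<open>transported_counit_right\<close>, \<open>transported_counit_left\<close>).
  \<^item> For \<open>u\<close> with the 2-cell \<open>Gu b \<epsilon>\<close>, compatibility with comultiplication is again the interchange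
    of two counits, now \<open>b \<epsilon>\<close> and \<open>G\<epsilon>\<close>, and compatibility with the counit is a triangle identity
    (\<open>lax_cell_comult\<close>, \<open>lax_cell_counit\<close>).

  The computations bring every 2-cell into the form of a single cell whiskered by one composite on
  the left and one on the right. Equations between 1-cells then act on the two composites, and two
  cells whose outer whiskers agree can be composed inside them.
\<close>

section \<open>Whiskering in a 2-category\<close>

context two_category
begin

text \<open>
  The typing rules are stated with \<open>src1\<close>, \<open>tgt1\<close>, \<open>src2\<close>, \<open>tgt2\<close> in place of hom-sets: their
  premises then mention no objects beyond the terms being typed, and the simplifier can discharge
  them by computing boundaries. The axioms used below are restated in the same style.
\<close>

lemma id1_typing [simp]:
  assumes "A \<in> objects K"
  shows "id1 K A \<in> arrows K" "src1 K (id1 K A) = A" "tgt1 K (id1 K A) = A"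
  using id1_hom[OF assms] by (simp_all add: hom1_def)

lemma comp1_typing [simp]:
  assumes "f \<in> arrows K" "g \<in> arrows K" "tgt1 K f = src1 K g"
  shows "g \<cdot> f \<in> arrows K" "src1 K (g \<cdot> f) = src1 K f" "tgt1 K (g \<cdot> f) = tgt1 K g"
  using comp1_hom[of f "src1 K f" "tgt1 K f" g "tgt1 K g"] assms by (simp_all add: hom1_def)

lemma comp1_id_left' [simp]:
  "\<lbrakk>f \<in> arrows K; tgt1 K f = B\<rbrakk> \<Longrightarrow> id1 K B \<cdot> f = f"
  by (rule comp1_id_left) (simp add: hom1_def)

lemma comp1_id_right' [simp]:
  "\<lbrakk>f \<in> arrows K; src1 K f = A\<rbrakk> \<Longrightarrow> f \<cdot> id1 K A = f"
  by (rule comp1_id_right) (simp add: hom1_def)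

lemma comp1_assoc' [simp]:
  "\<lbrakk>f \<in> arrows K; g \<in> arrows K; h \<in> arrows K; tgt1 K f = src1 K g; tgt1 K g = src1 K h\<rbrakk>
    \<Longrightarrow> (h \<cdot> g) \<cdot> f = h \<cdot> g \<cdot> f"
  by (rule comp1_assoc) (auto simp: hom1_def)

lemma boundary_typing [simp]:
  assumes "\<sigma> \<in> twocells K"
  shows "src2 K \<sigma> \<in> arrows K" "tgt2 K \<sigma> \<in> arrows K"
    "src1 K (tgt2 K \<sigma>) = src1 K (src2 K \<sigma>)" "tgt1 K (tgt2 K \<sigma>) = tgt1 K (src2 K \<sigma>)"
  using assms by (simp_all add: src2_mor tgt2_mor src1_parallel tgt1_parallel)

lemma id2_typing [simp]:
  assumes "f \<in> arrows K"
  shows "id2 K f \<in> twocells K" "src2 K (id2 K f) = f" "tgt2 K (id2 K f) = f"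
  using id2_hom[OF assms] by (simp_all add: hom2_def)

lemma vcomp_typing [simp]:
  assumes "\<sigma> \<in> twocells K" "\<tau> \<in> twocells K" "tgt2 K \<sigma> = src2 K \<tau>"
  shows "\<tau> \<bullet> \<sigma> \<in> twocells K" "src2 K (\<tau> \<bullet> \<sigma>) = src2 K \<sigma>" "tgt2 K (\<tau> \<bullet> \<sigma>) = tgt2 K \<tau>"
  using vcomp_hom[of \<sigma> "src2 K \<sigma>" "tgt2 K \<sigma>" \<tau> "tgt2 K \<tau>"] assms by (simp_all add: hom2_def)

lemma vcomp_id_left' [simp]:
  "\<lbrakk>\<sigma> \<in> twocells K; tgt2 K \<sigma> = g\<rbrakk> \<Longrightarrow> id2 K g \<bullet> \<sigma> = \<sigma>"
  by (rule vcomp_id_left) (simp add: hom2_def)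

lemma vcomp_id_right' [simp]:
  "\<lbrakk>\<sigma> \<in> twocells K; src2 K \<sigma> = f\<rbrakk> \<Longrightarrow> \<sigma> \<bullet> id2 K f = \<sigma>"
  by (rule vcomp_id_right) (simp add: hom2_def)

lemma whisker_left_typing [simp]:
  assumes "\<sigma> \<in> twocells K" "g \<in> arrows K" "tgt1 K (src2 K \<sigma>) = src1 K g"
  shows "g \<triangleright> \<sigma> \<in> twocells K" "src2 K (g \<triangleright> \<sigma>) = g \<cdot> src2 K \<sigma>" "tgt2 K (g \<triangleright> \<sigma>) = g \<cdot> tgt2 K \<sigma>"
  using hcomp_hom[of "src2 K \<sigma>" "src1 K (src2 K \<sigma>)" "tgt1 K (src2 K \<sigma>)" g "tgt1 K g" \<sigma> "tgt2 K \<sigma>"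
      "id2 K g" g] assms
  by (simp_all add: hom1_def hom2_def whisker_left_def)

lemma whisker_right_typing [simp]:
  assumes "\<sigma> \<in> twocells K" "f \<in> arrows K" "src1 K (src2 K \<sigma>) = tgt1 K f"
  shows "\<sigma> \<triangleleft> f \<in> twocells K" "src2 K (\<sigma> \<triangleleft> f) = src2 K \<sigma> \<cdot> f" "tgt2 K (\<sigma> \<triangleleft> f) = tgt2 K \<sigma> \<cdot> f"
  using hcomp_hom[of f "src1 K f" "tgt1 K f" "src2 K \<sigma>" "tgt1 K (src2 K \<sigma>)" "id2 K f" f
      \<sigma> "tgt2 K \<sigma>"] assms
  by (simp_all add: hom1_def hom2_def whisker_right_def)

lemma whisker_id2 [simp]:
  assumes "f \<in> arrows K" "g \<in> arrows K" "tgt1 K f = src1 K g"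
  shows "g \<triangleright> id2 K f = id2 K (g \<cdot> f)" "id2 K g \<triangleleft> f = id2 K (g \<cdot> f)"
  using assms hcomp_id2[of f "src1 K f" "tgt1 K f" g "tgt1 K g"]
  by (simp_all add: hom1_def whisker_left_def whisker_right_def)

lemma whisker_left_id1 [simp]:
  assumes "\<sigma> \<in> twocells K" "tgt1 K (src2 K \<sigma>) = B"
  shows "id1 K B \<triangleright> \<sigma> = \<sigma>"
  unfolding whisker_left_def
  by (rule hcomp_id_left[of "src2 K \<sigma>" "src1 K (src2 K \<sigma>)"]) (use assms in \<open>auto simp: hom1_def hom2_def\<close>)

lemma hcomp_assoc':
  assumes "\<rho> \<in> twocells K" "\<sigma> \<in> twocells K" "\<tau> \<in> twocells K"
    "tgt1 K (src2 K \<rho>) = src1 K (src2 K \<sigma>)" "tgt1 K (src2 K \<sigma>) = src1 K (src2 K \<tau>)"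
  shows "(\<tau> \<star> \<sigma>) \<star> \<rho> = \<tau> \<star> (\<sigma> \<star> \<rho>)"
  by (rule hcomp_assoc) (use assms in \<open>auto simp: hom1_def hom2_def\<close>)

lemma whisker_left_comp1:
  assumes "\<sigma> \<in> twocells K" "g \<in> arrows K" "h \<in> arrows K"
    "tgt1 K (src2 K \<sigma>) = src1 K g" "tgt1 K g = src1 K h"
  shows "(h \<cdot> g) \<triangleright> \<sigma> = h \<triangleright> g \<triangleright> \<sigma>"
  using hcomp_assoc'[of \<sigma> "id2 K g" "id2 K h"] whisker_id2(1)[of g h] assms
  by (simp add: whisker_left_def)

lemma whisker_right_comp1:
  assumes "\<sigma> \<in> twocells K" "f \<in> arrows K" "g \<in> arrows K"
    "src1 K (src2 K \<sigma>) = tgt1 K g" "tgt1 K f = src1 K g"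
  shows "\<sigma> \<triangleleft> (g \<cdot> f) = \<sigma> \<triangleleft> g \<triangleleft> f"
  using hcomp_assoc'[of "id2 K f" "id2 K g" \<sigma>] whisker_id2(2)[of f g] assms
  by (simp add: whisker_right_def)

lemma whisker_left_right:
  assumes "\<sigma> \<in> twocells K" "f \<in> arrows K" "h \<in> arrows K"
    "src1 K (src2 K \<sigma>) = tgt1 K f" "tgt1 K (src2 K \<sigma>) = src1 K h"
  shows "(h \<triangleright> \<sigma>) \<triangleleft> f = h \<triangleright> \<sigma> \<triangleleft> f"
  using hcomp_assoc'[of "id2 K f" \<sigma> "id2 K h"] assms
  by (simp add: whisker_left_def whisker_right_def)

lemma interchange':
  assumes "\<sigma> \<in> twocells K" "\<sigma>' \<in> twocells K" "\<tau> \<in> twocells K" "\<tau>' \<in> twocells K"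
    "tgt2 K \<sigma> = src2 K \<sigma>'" "tgt2 K \<tau> = src2 K \<tau>'" "tgt1 K (src2 K \<sigma>) = src1 K (src2 K \<tau>)"
  shows "(\<tau>' \<star> \<sigma>') \<bullet> (\<tau> \<star> \<sigma>) = (\<tau>' \<bullet> \<tau>) \<star> (\<sigma>' \<bullet> \<sigma>)"
  by (rule interchange[symmetric]) (use assms in \<open>auto simp: hom1_def hom2_def\<close>)

lemma whisker_left_vcomp:
  assumes "\<sigma> \<in> twocells K" "\<tau> \<in> twocells K" "tgt2 K \<sigma> = src2 K \<tau>"
    "g \<in> arrows K" "tgt1 K (src2 K \<sigma>) = src1 K g"
  shows "(g \<triangleright> \<tau>) \<bullet> (g \<triangleright> \<sigma>) = g \<triangleright> (\<tau> \<bullet> \<sigma>)"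
  using interchange'[of \<sigma> \<tau> "id2 K g" "id2 K g"] assms by (simp add: whisker_left_def)

lemma whisker_right_vcomp:
  assumes "\<sigma> \<in> twocells K" "\<tau> \<in> twocells K" "tgt2 K \<sigma> = src2 K \<tau>"
    "f \<in> arrows K" "src1 K (src2 K \<sigma>) = tgt1 K f"
  shows "(\<tau> \<triangleleft> f) \<bullet> (\<sigma> \<triangleleft> f) = (\<tau> \<bullet> \<sigma>) \<triangleleft> f"
  using interchange'[of "id2 K f" "id2 K f" \<sigma> \<tau>] assms by (simp add: whisker_right_def)

text \<open>
  Both sides equal the horizontal composite of \<open>\<tau>\<close> and \<open>\<sigma>\<close>. This is how two cells
  acting at different places of a composite can trade their order.
\<close>

lemma whisker_interchange:
  assumes "\<sigma> \<in> twocells K" "\<tau> \<in> twocells K" "tgt1 K (src2 K \<sigma>) = src1 K (src2 K \<tau>)"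
  shows "(\<tau> \<triangleleft> tgt2 K \<sigma>) \<bullet> (src2 K \<tau> \<triangleright> \<sigma>) = (tgt2 K \<tau> \<triangleright> \<sigma>) \<bullet> (\<tau> \<triangleleft> src2 K \<sigma>)"
  using interchange'[of \<sigma> "id2 K (tgt2 K \<sigma>)" "id2 K (src2 K \<tau>)" \<tau>]
    interchange'[of "id2 K (src2 K \<sigma>)" \<sigma> \<tau> "id2 K (tgt2 K \<tau>)"] assms
  by (simp add: whisker_left_def whisker_right_def)

text \<open>
  Composites are kept associated to the right, where a two-factor equation no longer matches the
  two factors once something is precomposed with them.
\<close>

lemma extend_comp1:
  assumes "h \<cdot> g = h' \<cdot> g'" "g \<in> arrows K" "h \<in> arrows K" "g' \<in> arrows K" "h' \<in> arrows K"
    "tgt1 K g = src1 K h" "tgt1 K g' = src1 K h'"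
    "k \<in> arrows K" "tgt1 K k = src1 K g" "tgt1 K k = src1 K g'"
  shows "h \<cdot> g \<cdot> k = h' \<cdot> g' \<cdot> k"
  using assms comp1_assoc'[of k g h] comp1_assoc'[of k g' h'] by simp

text \<open>
  Used as rewrite rules, these produce the normal form \<open>g \<triangleright> \<sigma> \<triangleleft> f\<close> with a single composite on
  either side of \<open>\<sigma>\<close>.
\<close>

lemmas collect_whiskers =
  whisker_left_comp1 [symmetric] whisker_right_comp1 [symmetric] whisker_left_right

end


section \<open>2-functors, 2-comonads and whiskering\<close>

context two_functor
begin

lemma ob_typing [simp]: "A \<in> objects K \<Longrightarrow> ob F A \<in> objects L"
  by (rule ob_obj)

lemma mor_typing [simp]:
  assumes "f \<in> arrows K"
  shows "mor F f \<in> arrows L" "src1 L (mor F f) = ob F (src1 K f)"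
    "tgt1 L (mor F f) = ob F (tgt1 K f)"
  using mor_hom[of f "src1 K f" "tgt1 K f"] assms by (simp_all add: hom1_def)

lemma cell_typing [simp]:
  assumes "\<sigma> \<in> twocells K"
  shows "cell F \<sigma> \<in> twocells L" "src2 L (cell F \<sigma>) = mor F (src2 K \<sigma>)"
    "tgt2 L (cell F \<sigma>) = mor F (tgt2 K \<sigma>)"
  using cell_hom[of \<sigma> "src2 K \<sigma>" "tgt2 K \<sigma>"] assms by (simp_all add: hom2_def)

lemma mor_comp1' [simp]:
  "\<lbrakk>f \<in> arrows K; g \<in> arrows K; tgt1 K f = src1 K g\<rbrakk>
    \<Longrightarrow> mor F (g \<cdot>\<^bsub>K\<^esub> f) = mor F g \<cdot>\<^bsub>L\<^esub> mor F f"
  by (rule mor_comp1) (auto simp: hom1_def)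

lemma cell_vcomp':
  "\<lbrakk>\<sigma> \<in> twocells K; \<tau> \<in> twocells K; tgt2 K \<sigma> = src2 K \<tau>\<rbrakk>
    \<Longrightarrow> cell F (\<tau> \<bullet>\<^bsub>K\<^esub> \<sigma>) = cell F \<tau> \<bullet>\<^bsub>L\<^esub> cell F \<sigma>"
  by (rule cell_vcomp) (auto simp: hom2_def)

lemma cell_whisker_left [simp]:
  assumes "\<sigma> \<in> twocells K" "g \<in> arrows K" "tgt1 K (src2 K \<sigma>) = src1 K g"
  shows "cell F (g \<triangleright>\<^bsub>K\<^esub> \<sigma>) = mor F g \<triangleright>\<^bsub>L\<^esub> cell F \<sigma>"
  using cell_hcomp[of "src2 K \<sigma>" "src1 K (src2 K \<sigma>)" "tgt1 K (src2 K \<sigma>)" g "tgt1 K g" \<sigma> "tgt2 K \<sigma>"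
      "id2 K g" g] assms
  by (simp add: hom1_def hom2_def whisker_left_def cell_id2)

lemma cell_whisker_right [simp]:
  assumes "\<sigma> \<in> twocells K" "f \<in> arrows K" "src1 K (src2 K \<sigma>) = tgt1 K f"
  shows "cell F (\<sigma> \<triangleleft>\<^bsub>K\<^esub> f) = cell F \<sigma> \<triangleleft>\<^bsub>L\<^esub> mor F f"
  using cell_hcomp[of f "src1 K f" "tgt1 K f" "src2 K \<sigma>" "tgt1 K (src2 K \<sigma>)" "id2 K f" f
      \<sigma> "tgt2 K \<sigma>"] assms
  by (simp add: hom1_def hom2_def whisker_right_def cell_id2)

end

context two_comonad
begin

lemma comult_typing [simp]:
  assumes "A \<in> objects K"
  shows "d A \<in> arrows K" "src1 K (d A) = ob G A" "tgt1 K (d A) = ob G (ob G A)"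
  using comult.component_hom[OF assms] by (simp_all add: hom1_def comp_two_fun_def)

lemma counit_typing [simp]:
  assumes "A \<in> objects K"
  shows "e A \<in> arrows K" "src1 K (e A) = ob G A" "tgt1 K (e A) = A"
  using counit.component_hom[OF assms] by (simp_all add: hom1_def id_two_fun_def)

lemma comult_natural:
  "h \<in> hom1 K A B \<Longrightarrow> d B \<cdot> mor G h = mor G (mor G h) \<cdot> d A"
  using comult.natural by (simp add: comp_two_fun_def)

lemma counit_natural:
  "h \<in> hom1 K A B \<Longrightarrow> e B \<cdot> mor G h = h \<cdot> e A"
  using counit.natural by (simp add: id_two_fun_def)

lemma comult_natural2:
  "\<lbrakk>h \<in> hom1 K A B; \<sigma> \<in> hom2 K h h'\<rbrakk> \<Longrightarrow> d B \<triangleright> cell G \<sigma> = cell G (cell G \<sigma>) \<triangleleft> d A"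
  using comult.natural2 by (simp add: comp_two_fun_def)

lemma counit_natural2:
  "\<lbrakk>h \<in> hom1 K A B; \<sigma> \<in> hom2 K h h'\<rbrakk> \<Longrightarrow> e B \<triangleright> cell G \<sigma> = \<sigma> \<triangleleft> e A"
  using counit.natural2 by (simp add: id_two_fun_def)

end

context strict_coalgebra
begin

lemma coaction_typing [simp]:
  "B \<in> objects K" "b \<in> arrows K" "src1 K b = B" "tgt1 K b = ob G B"
  using carrier_obj coaction_hom by (simp_all add: hom1_def)

lemma comult_comult_coaction:
  "mor G (d B) \<cdot> d B \<cdot> b = d (ob G B) \<cdot> d B \<cdot> b"
proof -
  have "mor G (d B) \<cdot> d B \<cdot> b = (mor G (d B) \<cdot> d B) \<cdot> b" by simp
  also have "\<dots> = d (ob G B) \<cdot> d B \<cdot> b" by (subst coassoc) simp_all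
  finally show ?thesis .
qed

text \<open>
  All 2-cells involved are identities, so only their boundaries have to be compared. For
  coassociativity this uses strict coassociativity and the naturality of \<open>d\<close> at \<open>b\<close>.
\<close>

lemma strict_is_lax_coalgebra:
  "lax_coalgebra K G d e B b (id2 K (d B \<cdot> b)) (id2 K (id1 K B))"
proof unfold_locales
  have 1: "mor G (e B) \<cdot> d B \<cdot> b = b"
    using counit_right[of B] dom.comp1_assoc'[of b "d B" "mor G (e B)"] by simp
  have 2: "e (ob G B) \<cdot> d B \<cdot> b = b"
    using counit_left[of B] dom.comp1_assoc'[of b "d B" "e (ob G B)"] by simp
  have 3: "mor G (mor G b) \<cdot> d B \<cdot> b = d (ob G B) \<cdot> d B \<cdot> b"
    using comult_natural[OF coaction_hom] coaction_comult
      dom.comp1_assoc'[of b "d B" "mor G (mor G b)"] dom.comp1_assoc'[of b "mor G b" "d (ob G B)"]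
    by simp
  show "B \<in> objects K" by simp
  show "b \<in> hom1 K B (ob G B)" by (rule coaction_hom)
  show "id2 K (d B \<cdot> b) \<in> hom2 K (mor G b \<cdot> b) (d B \<cdot> b)"
    by (simp add: hom2_def coaction_comult)
  show "id2 K (id1 K B) \<in> hom2 K (id1 K B) (e B \<cdot> b)"
    by (simp add: hom2_def coaction_counit)
  show "(mor G (d B) \<triangleright> id2 K (d B \<cdot> b)) \<bullet> (cell G (id2 K (d B \<cdot> b)) \<triangleleft> b)
      = (d (ob G B) \<triangleright> id2 K (d B \<cdot> b)) \<bullet> (mor G (mor G b) \<triangleright> id2 K (d B \<cdot> b))"
    using comult_comult_coaction by (simp add: cell_id2 3 coaction_comult)
  show "(mor G (e B) \<triangleright> id2 K (d B \<cdot> b)) \<bullet> (cell G (id2 K (id1 K B)) \<triangleleft> b) = id2 K b"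
    by (simp add: cell_id2 mor_id1 1)
  show "(e (ob G B) \<triangleright> id2 K (d B \<cdot> b)) \<bullet> (b \<triangleright> id2 K (id1 K B)) = id2 K b"
    by (simp add: 2)
qed

end


section \<open>Transporting a strict coalgebra along an adjunction\<close>

locale coalgebra_with_right_adjoint =
  adjunction K A B f u \<eta> \<epsilon> + strict_coalgebra K G d e B b
  for K :: "('o, 'm, 'c) two_cat" (structure)
    and A B :: 'o and f u :: 'm and \<eta> \<epsilon> :: 'c
    and G :: "('o, 'm, 'c, 'o, 'm, 'c) two_fun"
    and d e :: "'o \<Rightarrow> 'm" and b :: 'm
begin

abbreviation "Gu \<equiv> mor G u"
abbreviation "GGu \<equiv> mor G Gu"
abbreviation "Gf \<equiv> mor G f"
abbreviation "Gb \<equiv> mor G b"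
abbreviation "GGb \<equiv> mor G Gb"
abbreviation "G\<epsilon> \<equiv> cell G \<epsilon>"
abbreviation "G\<eta> \<equiv> cell G \<eta>"

text \<open>
  The three pieces of structure on \<open>A\<close> and \<open>u\<close>; the remaining 2-cell \<open>1 \<Rightarrow> eA a\<close> is \<open>\<eta>\<close> itself.
\<close>

definition transported_coaction :: 'm where
  "transported_coaction = Gu \<cdot> b \<cdot> f"

definition transported_comult :: 'c where
  "transported_comult = (GGu \<cdot> Gb) \<triangleright> G\<epsilon> \<triangleleft> (b \<cdot> f)"

definition transported_lax_cell :: 'c where
  "transported_lax_cell = (Gu \<cdot> b) \<triangleright> \<epsilon>"

lemma adjunction_typing [simp]:
  "A \<in> objects K"
  "f \<in> arrows K" "src1 K f = A" "tgt1 K f = B"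
  "u \<in> arrows K" "src1 K u = B" "tgt1 K u = A"
  "\<eta> \<in> twocells K" "src2 K \<eta> = id1 K A" "tgt2 K \<eta> = u \<cdot> f"
  "\<epsilon> \<in> twocells K" "src2 K \<epsilon> = f \<cdot> u" "tgt2 K \<epsilon> = id1 K B"
  using left_hom right_hom unit_hom counit_hom src1_obj[of f]
  by (auto simp: hom1_def hom2_def)

lemma comult_right_adjoint: "d A \<cdot> Gu = GGu \<cdot> d B"
  by (rule comult_natural) (rule right_hom)

lemma counit_right_adjoint: "e A \<cdot> Gu = u \<cdot> e B"
  by (rule counit_natural) (rule right_hom)

lemma comult_coaction: "d (ob G B) \<cdot> Gb = GGb \<cdot> d B"
  by (rule comult_natural) (rule coaction_hom)

lemma counit_coaction: "e (ob G B) \<cdot> Gb = b \<cdot> e B"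
  by (rule counit_natural) (rule coaction_hom)

text \<open>
  Naturality of \<open>d\<close> and \<open>e\<close> on 2-cells: \<open>d\<close> carries \<open>G\<epsilon>\<close> to \<open>GG\<epsilon>\<close>, which supplies the second of the
  two cells to be interchanged in coassociativity, and \<open>e\<close> carries it back to \<open>\<epsilon>\<close>, to which the
  triangle identity at \<open>f\<close> applies.
\<close>

lemma comult_counit_cell: "d B \<triangleright> G\<epsilon> = cell G G\<epsilon> \<triangleleft> d B"
  by (rule comult_natural2[OF _ counit_hom]) (simp add: hom1_def)

lemma counit_counit_cell: "e B \<triangleright> G\<epsilon> = \<epsilon> \<triangleleft> e B"
  by (rule counit_natural2[OF _ counit_hom]) (simp add: hom1_def)

lemma map_comult_coaction: "mor G (d B) \<cdot> Gb = GGb \<cdot> Gb"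
  using arg_cong[OF coaction_comult, of "mor G"] by simp

lemma map_counit_coaction: "mor G (e B) \<cdot> Gb = id1 K (ob G B)"
  using arg_cong[OF coaction_counit, of "mor G"] by (simp add: mor_id1)

lemma map_comult_right_adjoint: "mor G (d A) \<cdot> GGu = mor G GGu \<cdot> mor G (d B)"
  using arg_cong[OF comult_right_adjoint, of "mor G"] by simp

lemma map_counit_right_adjoint: "mor G (e A) \<cdot> GGu = Gu \<cdot> mor G (e B)"
  using arg_cong[OF counit_right_adjoint, of "mor G"] by simp

lemma comult_coaction_left_adjoint: "d B \<cdot> b \<cdot> f = Gb \<cdot> b \<cdot> f"
  by (rule extend_comp1[OF coaction_comult[symmetric]]) simp_all

lemma counit_coaction_left_adjoint: "e B \<cdot> b \<cdot> f = f"
  using comp1_assoc'[of f b "e B"] by (simp add: coaction_counit)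

text \<open>
  The targets claimed for \<open>\<alpha>\<close> and \<open>\<eta>\<close> agree with the targets that their defining composites
  have, thanks to naturality together with the strict laws of \<open>b\<close>.
\<close>

lemma comult_transported_coaction:
  "d A \<cdot> transported_coaction = GGu \<cdot> Gb \<cdot> b \<cdot> f"
proof -
  have "d A \<cdot> Gu \<cdot> b \<cdot> f = GGu \<cdot> d B \<cdot> b \<cdot> f"
    by (rule extend_comp1[OF comult_right_adjoint]) simp_all
  also have "\<dots> = GGu \<cdot> Gb \<cdot> b \<cdot> f" by (simp add: comult_coaction_left_adjoint)
  finally show ?thesis by (simp add: transported_coaction_def)
qed

lemma counit_transported_coaction: "e A \<cdot> transported_coaction = u \<cdot> f"
proof -
  have "e A \<cdot> Gu \<cdot> b \<cdot> f = u \<cdot> e B \<cdot> b \<cdot> f"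
    by (rule extend_comp1[OF counit_right_adjoint]) simp_all
  also have "\<dots> = u \<cdot> f" by (simp add: counit_coaction_left_adjoint)
  finally show ?thesis by (simp add: transported_coaction_def)
qed

lemma transported_coaction_typing [simp]:
  "transported_coaction \<in> arrows K" "src1 K transported_coaction = A"
  "tgt1 K transported_coaction = ob G A"
  by (simp_all add: transported_coaction_def)

lemma transported_comult_typing [simp]:
  "transported_comult \<in> twocells K"
  "src2 K transported_comult = mor G transported_coaction \<cdot> transported_coaction"
  "tgt2 K transported_comult = d A \<cdot> transported_coaction"
  unfolding comult_transported_coaction
  by (simp_all add: transported_comult_def transported_coaction_def mor_id1)

text \<open>
  Two of the four cells visibly have the left factor \<open>?P = GGGu GGb\<close>; the 1-cell equations \<open>PL\<close> and \<open>PR\<close>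
  produce it in the other two. Inside \<open>?P\<close> and the right factor \<open>b f\<close>, one side cancels the outer \<open>GGf GGu\<close> before the inner \<open>Gf Gu\<close> and the
  other side does so after it.
\<close>

lemma transported_coassoc:
  "(mor G (d A) \<triangleright> transported_comult) \<bullet> (cell G transported_comult \<triangleleft> transported_coaction)
    = (d (ob G A) \<triangleright> transported_comult)
        \<bullet> (mor G (mor G transported_coaction) \<triangleright> transported_comult)"
proof -
  let ?P = "mor G GGu \<cdot> GGb"
  have PL: "mor G (d A) \<cdot> GGu \<cdot> Gb = mor G GGu \<cdot> GGb \<cdot> Gb"
    using extend_comp1[OF map_comult_right_adjoint, of Gb] by (simp add: map_comult_coaction)
  have PR: "d (ob G A) \<cdot> GGu \<cdot> Gb = mor G GGu \<cdot> GGb \<cdot> d B"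
    using extend_comp1[OF comult_natural[of Gu "ob G B" "ob G A"], of Gb]
    by (simp add: hom1_def comult_coaction)
  have "mor G (d A) \<triangleright> transported_comult = ?P \<triangleright> (Gb \<triangleright> G\<epsilon>) \<triangleleft> (b \<cdot> f)"
    by (simp add: transported_comult_def collect_whiskers PL)
  moreover have "cell G transported_comult \<triangleleft> transported_coaction
      = ?P \<triangleright> (cell G G\<epsilon> \<triangleleft> (Gb \<cdot> Gf \<cdot> Gu)) \<triangleleft> (b \<cdot> f)"
    by (simp add: transported_comult_def transported_coaction_def collect_whiskers)
  moreover have "d (ob G A) \<triangleright> transported_comult = ?P \<triangleright> (cell G G\<epsilon> \<triangleleft> Gb) \<triangleleft> (b \<cdot> f)"
  proof -
    have "d (ob G A) \<triangleright> transported_comult = (?P \<cdot> d B) \<triangleright> G\<epsilon> \<triangleleft> (b \<cdot> f)"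
      by (simp add: transported_comult_def collect_whiskers PR)
    also have "\<dots> = ?P \<triangleright> (d B \<triangleright> G\<epsilon>) \<triangleleft> (b \<cdot> f)"
      by (simp add: collect_whiskers)
    also have "\<dots> = ?P \<triangleright> (cell G G\<epsilon> \<triangleleft> Gb) \<triangleleft> (b \<cdot> f)"
      unfolding comult_counit_cell by (simp add: collect_whiskers comult_coaction_left_adjoint)
    finally show ?thesis .
  qed
  moreover have "mor G (mor G transported_coaction) \<triangleright> transported_comult
      = ?P \<triangleright> ((mor G Gf \<cdot> GGu) \<triangleright> Gb \<triangleright> G\<epsilon>) \<triangleleft> (b \<cdot> f)"
    by (simp add: transported_comult_def transported_coaction_def collect_whiskers)
  \<comment> \<open>The two orders of cancellation agree.\<close>
  moreover have "(Gb \<triangleright> G\<epsilon>) \<bullet> (cell G G\<epsilon> \<triangleleft> (Gb \<cdot> Gf \<cdot> Gu))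
      = (cell G G\<epsilon> \<triangleleft> Gb) \<bullet> ((mor G Gf \<cdot> GGu) \<triangleright> Gb \<triangleright> G\<epsilon>)"
    using whisker_interchange[of "Gb \<triangleright> G\<epsilon>" "cell G G\<epsilon>"] by (simp add: mor_id1)
  ultimately show ?thesis
    by (simp add: whisker_left_vcomp whisker_right_vcomp mor_id1)
qed

text \<open>
  Applying \<open>GeA\<close> removes the coaction \<open>Gb\<close> that was inserted to the left of \<open>G\<epsilon>\<close>; the image under
  \<open>G\<close> of the triangle identity at \<open>u\<close> remains.
\<close>

lemma transported_counit_right:
  "(mor G (e A) \<triangleright> transported_comult) \<bullet> (G\<eta> \<triangleleft> transported_coaction)
    = id2 K transported_coaction"
proof -
  have "mor G (e A) \<cdot> GGu \<cdot> Gb = Gu"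
    using extend_comp1[OF map_counit_right_adjoint, of Gb] by (simp add: map_counit_coaction)
  then have "mor G (e A) \<triangleright> transported_comult = (Gu \<triangleright> G\<epsilon>) \<triangleleft> (b \<cdot> f)"
    by (simp add: transported_comult_def collect_whiskers)
  moreover have "G\<eta> \<triangleleft> transported_coaction = (G\<eta> \<triangleleft> Gu) \<triangleleft> (b \<cdot> f)"
    by (simp add: transported_coaction_def collect_whiskers mor_id1)
  moreover have "(Gu \<triangleright> G\<epsilon>) \<bullet> (G\<eta> \<triangleleft> Gu) = id2 K Gu"
    using arg_cong[OF triangle_right, of "cell G"] by (simp add: cell_vcomp' cell_id2)
  ultimately show ?thesis
    by (simp add: whisker_right_vcomp mor_id1 transported_coaction_def)
qed

text \<open>
  Moving \<open>eGA\<close> through \<open>GGu Gb\<close> brings it to \<open>eB\<close>, just before \<open>G\<epsilon>\<close>, which it turns into \<open>\<epsilon>\<close>; what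
  is left of \<open>eB\<close> then cancels against \<open>b\<close>, and the triangle identity at \<open>f\<close> remains.
\<close>

lemma transported_counit_left:
  "(e (ob G A) \<triangleright> transported_comult) \<bullet> (transported_coaction \<triangleright> \<eta>)
    = id2 K transported_coaction"
proof -
  let ?P = "Gu \<cdot> b"
  have P: "e (ob G A) \<cdot> GGu \<cdot> Gb = Gu \<cdot> b \<cdot> e B"
    using extend_comp1[OF counit_natural[of Gu "ob G B" "ob G A"], of Gb]
    by (simp add: hom1_def counit_coaction)
  have "e (ob G A) \<triangleright> transported_comult = (?P \<cdot> e B) \<triangleright> G\<epsilon> \<triangleleft> (b \<cdot> f)"
    by (simp add: transported_comult_def collect_whiskers P)
  also have "\<dots> = ?P \<triangleright> (e B \<triangleright> G\<epsilon>) \<triangleleft> (b \<cdot> f)"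
    by (simp add: collect_whiskers)
  also have "\<dots> = ?P \<triangleright> \<epsilon> \<triangleleft> f"
    unfolding counit_counit_cell by (simp add: collect_whiskers counit_coaction_left_adjoint)
  finally have "e (ob G A) \<triangleright> transported_comult = ?P \<triangleright> \<epsilon> \<triangleleft> f" .
  moreover have "transported_coaction \<triangleright> \<eta> = ?P \<triangleright> f \<triangleright> \<eta>"
    by (simp add: transported_coaction_def collect_whiskers)
  ultimately show ?thesis
    by (simp add: whisker_left_vcomp triangle_left transported_coaction_def)
qed

lemma transported_lax_coalgebra:
  "lax_coalgebra K G d e A transported_coaction transported_comult \<eta>"
proof unfold_locales
  show "\<eta> \<in> hom2 K (id1 K A) (e A \<cdot> transported_coaction)"
    by (simp add: hom2_def counit_transported_coaction)
qed (simp_all add: hom1_def hom2_def transported_coassoc transported_counit_right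
      transported_counit_left)

text \<open>
  With the common left factor \<open>?P = GGu Gb\<close> removed, both sides start at \<open>Gf Gu b f u\<close> and cancel the two
  copies of \<open>f u\<close>, in opposite orders.
\<close>

lemma lax_cell_comult:
  "(d A \<triangleright> transported_lax_cell) \<bullet> (transported_comult \<triangleleft> u)
    = (GGu \<triangleright> id2 K (d B \<cdot> b)) \<bullet> (cell G transported_lax_cell \<triangleleft> b)
        \<bullet> (mor G transported_coaction \<triangleright> transported_lax_cell)"
proof -
  let ?P = "GGu \<cdot> Gb"
  have P: "d A \<cdot> Gu \<cdot> b = GGu \<cdot> Gb \<cdot> b"
    using extend_comp1[OF comult_right_adjoint, of b] by (simp add: coaction_comult)
  have "d A \<triangleright> transported_lax_cell = ?P \<triangleright> b \<triangleright> \<epsilon>"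
    by (simp add: transported_lax_cell_def collect_whiskers P)
  moreover have "transported_comult \<triangleleft> u = ?P \<triangleright> G\<epsilon> \<triangleleft> (b \<cdot> f \<cdot> u)"
    by (simp add: transported_comult_def collect_whiskers)
  moreover have "(GGu \<triangleright> id2 K (d B \<cdot> b)) \<bullet> (cell G transported_lax_cell \<triangleleft> b)
        \<bullet> (mor G transported_coaction \<triangleright> transported_lax_cell)
      = (?P \<triangleright> G\<epsilon> \<triangleleft> b) \<bullet> (?P \<triangleright> (Gf \<cdot> Gu) \<triangleright> b \<triangleright> \<epsilon>)"
    by (simp add: transported_lax_cell_def transported_coaction_def collect_whiskers mor_id1
        coaction_comult)
  moreover have "(b \<triangleright> \<epsilon>) \<bullet> (G\<epsilon> \<triangleleft> (b \<cdot> f \<cdot> u)) = (G\<epsilon> \<triangleleft> b) \<bullet> ((Gf \<cdot> Gu) \<triangleright> b \<triangleright> \<epsilon>)"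
    using whisker_interchange[of "b \<triangleright> \<epsilon>" G\<epsilon>] by (simp add: mor_id1)
  ultimately show ?thesis
    by (simp add: whisker_left_vcomp mor_id1)
qed

text \<open>
  As \<open>eA Gu b = u eB b = u\<close>, the left-hand side is that of the triangle identity at \<open>u\<close>.
\<close>

lemma lax_cell_counit:
  "(e A \<triangleright> transported_lax_cell) \<bullet> (\<eta> \<triangleleft> u) = u \<triangleright> id2 K (id1 K B)"
proof -
  have "e A \<cdot> Gu \<cdot> b = u"
    using extend_comp1[OF counit_right_adjoint, of b] by (simp add: coaction_counit)
  then have "e A \<triangleright> transported_lax_cell = u \<triangleright> \<epsilon>"
    by (simp add: transported_lax_cell_def collect_whiskers)
  then show ?thesis by (simp add: triangle_right)
qed

lemma right_adjoint_lax_morphism: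
  "lax_morphism K G d e B b (id2 K (d B \<cdot> b)) (id2 K (id1 K B))
    A transported_coaction transported_comult \<eta> u transported_lax_cell"
proof -
  interpret dom: lax_coalgebra K G d e B b "id2 K (d B \<cdot> b)" "id2 K (id1 K B)"
    by (rule strict_is_lax_coalgebra)
  interpret cod: lax_coalgebra K G d e A transported_coaction transported_comult \<eta>
    by (rule transported_lax_coalgebra)
  show ?thesis
  proof unfold_locales
    show "u \<in> hom1 K B A" by (rule right_hom)
    show "transported_lax_cell \<in> hom2 K (transported_coaction \<cdot> u) (Gu \<cdot> b)"
      by (simp add: hom2_def transported_lax_cell_def transported_coaction_def)
  qed (rule lax_cell_comult lax_cell_counit)+
qed

end

theorem theorem8p3:
  fixes K :: "('o, 'm, 'c) two_cat" (structure)
    and G :: "('o, 'm, 'c, 'o, 'm, 'c) two_fun"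
    and d e :: "'o \<Rightarrow> 'm"
    and A B :: 'o and b f u a :: 'm
    and \<eta> \<epsilon> \<alpha> \<alpha>\<^sub>0 ubar :: 'c
  assumes "two_category K"
    and "two_comonad K G d e"
    and "strict_coalgebra K G d e B b"
    and "adjunction K A B f u \<eta> \<epsilon>"
    and "a = mor G u \<cdot> b \<cdot> f"
    and "\<alpha> = (mor G (mor G u) \<cdot> mor G b) \<triangleright> cell G \<epsilon> \<triangleleft> (b \<cdot> f)"
    and "\<alpha>\<^sub>0 = \<eta>"
    and "ubar = (mor G u \<cdot> b) \<triangleright> \<epsilon>"
  shows "lax_coalgebra K G d e A a \<alpha> \<alpha>\<^sub>0
    \<and> lax_morphism K G d e B b (id2 K (d B \<cdot> b)) (id2 K (id1 K B)) A a \<alpha> \<alpha>\<^sub>0 u ubar"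
proof -
  interpret coalgebra_with_right_adjoint K A B f u \<eta> \<epsilon> G d e b
    using assms(3,4) by (simp add: coalgebra_with_right_adjoint_def)
  have "a = transported_coaction" "\<alpha> = transported_comult" "ubar = transported_lax_cell"
    using assms
    by (simp_all only: transported_coaction_def transported_comult_def transported_lax_cell_def)
  then show ?thesis
    using transported_lax_coalgebra right_adjoint_lax_morphism assms(7) by simp
qed

end
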